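(* Let $P$ be a program, $b_0$ a boolean variable of $P$, and $A^*,B^*$ infinite sets over which equality is decidable. In the following, $A$ and $B$ range over non-empty finite subsets of $A^*$ and $B^*$ respectively. (1) For every formula $\overline{\varphi}$ of the universal fragment $\overline{L^\mu_2}$ of the $\mu$-calculus over the boolean variables of $P$: if $[\![P]\!]^*_{A^*,B^*}, b_0\models\overline{\varphi}$, then $[\![P]\!]_{A,B}, b_0\models\overline{\varphi}$ for all such $A,B$. (2) For every formula $\overline{\varphi}$ of the universal disjunction-free fragment $\overline{L^\mu_4}$ over the boolean variables of $P$: $[\![P]\!]^*_{A^*,B^*}, b_0\models\overline{\varphi}$ if and only if $[\![P]\!]_{A,B}, b_0\models\overline{\varphi}$ for all such $A,B$.
   Context: Transition systems are $(Q,\delta,[\![\cdot]\!],\mathcal{O})$: state space $Q$, successor function $\delta:Q\to 2^Q$, finite observables $\mathcal{O}$, extensions $[\![\cdot]\!]:\mathcal{O}\to 2^Q$. $\mu$-calculus: formulas $\varphi ::= p\mid\overline{p}\mid h\mid\varphi\vee\varphi\mid\varphi\wedge\varphi\mid\exists\bigcirc\varphi\mid\forall\bigcirc\varphi\mid(\mu h:\varphi)\mid(\nu h:\varphi)$ ($p$ observable, $h$ variable), with semantics relative to an environment $\mathcal{E}$: $[\![p]\!]_\mathcal{E}=[\![p]\!]$, $[\![\overline{p}]\!]_\mathcal{E}=Q\setminus[\![p]\!]$, $[\![h]\!]_\mathcal{E}=\mathcal{E}(h)$, $\vee,\wedge$ as union and intersection, $[\![\exists\bigcirc\varphi]\!]_\mathcal{E}=\{s:\exists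 s'\in\delta(s),\ s'\in[\![\varphi]\!]_\mathcal{E}\}$, $[\![\forall\bigcirc\varphi]\!]_\mathcal{E}=\{s:\forall s'\in\delta(s),\ s'\in[\![\varphi]\!]_\mathcal{E}\}$, $[\![\mu h:\varphi]\!]_\mathcal{E}$ (resp. $\nu$) the intersection (resp. union) of all $\tau\subseteq Q$ with $\tau=[\![\varphi]\!]_{\mathcal{E}[h\mapsto\tau]}$. Only closed formulas are considered; $\mathcal{S},s\models\varphi$ means $s\in[\![\varphi]\!]_\mathcal{E}$, and for a boolean variable $b_0$, $\mathcal{S},b_0\models\varphi$ means $\mathcal{S},s\models\varphi$ for every $s\in[\![b_0]\!]$. $L^\mu_2$ is the set of closed formulas without $\overline{p}$ and $\forall\bigcirc$; $L^\mu_4$ is the subset of $L^\mu_2$ without $\wedge$ and $\nu$. The dual $\overline{L}$ of such a logic $L$ consists of the formulas $\overline{\varphi}$ obtained from $\varphi\in L$ by replacing $p,\overline{p},\vee,\wedge,\exists\bigcirc,\forall\bigcirc,\mu,\nu$ by $\overline{p},p,\wedge,\vee,\forall\bigcirc,\exists\bigcirc,\nu,\mu$ respectively (so $\overline{L^\mu_2}$ is the universal fragment and $\overline{L^\mu_4}$ the universal disjunction-free fragment). Programs. Fix type symbols $X,Y$. A program $P$ has finitely many typed variables (boolean variables, $X$-variables, $Y$-variables, array variables indexed by $X$ storing $Y$) and finitely many guarded commands $e\longrightarrow I$, with boolean expressions $e ::= \mathbf{true}\mid\mathbf{false}\mid b\mid z=z'\mid\neg e\mid e\vee e$ ($z,z'$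 data variables of the same type). A command $I$ contains for each boolean $b$ at most one $b:=e$; for each data variable $z$ at most one of $z:=z'$, $z:=\,?$ (nondeterministic choice), or (for $z$ of type $Y$) a read $z:=a[x]$; for each array $a$ at most one write $a[x]:=y$. $E_s(e)$ is the usual evaluation of $e$ in state $s$. Normal semantics $[\![P]\!]_{A,B}$ ($A$ instantiating $X$, $B$ instantiating $Y$): states map booleans to truth values, $X$-variables into $A$, $Y$-variables into $B$, arrays to total functions $A\to B$; $s'\in\delta(s)$ iff some guarded command $e\longrightarrow I$ has $E_s(e)=\mathbf{true}$ and $s\,\Delta_I\,s'$, where $s\,\Delta_I\,s'$ iff (i) $s'(b)=E_s(e)$ if $b:=e\in I$, else $s'(b)=s(b)$; (ii) for data variables $z$: if $z:=z'\in I$ then $s'(z)=s(z')$, else if $z:=a[x]\in I$ then $s'(z)=s(a)(s(x))$, else either $z:=\,?\in I$ or $s'(z)=s(z)$; (iii) for arrays $a$ and $v\in A$: if $a[x]:=y\in I$ with $s(x)=v$ then $s'(a)(v)=s(y)$, else $s'(a)(v)=s(a)(v)$. Observables are the boolean variables with $[\![b]\!]=\{s:s(b)=\mathbf{true}\}$. Partial-functions semantics $[\![P]\!]^*_{A^*,B^*}$ ($A^*,B^*$ infinite): as the normal semantics except that each array $a$ is mapped to a partial function $s(a)$ from $A^*$ to $B^*$ with finite domain, defined at $s(x)$ for all $X$-variables $x$ ($\bot$ denotes undefined; $\bot=\bot$, $\bot\ne w$), and $\Delta_I$ is replaced by $\Delta^*_I$: (i),(ii) as before and (iii* ) for each array $a$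 and $v\in A^*$: if $a[x]:=y\in I$ with $s(x)=v$ then $s'(a)(v)=s(y)$; otherwise, if there is no $X$-variable $x$ with $x:=\,?\in I$, $s'(x)=v$ and $s(a)(v)=\bot$, then $s'(a)(v)=s(a)(v)$. *)

theory Defs
  imports Main "HOL-Library.FuncSet"
begin

section \<open>Transition systems and the mu-calculus\<close>

record ('s, 'p) ts =
  States :: "'s set"
  Succ :: "'s \<Rightarrow> 's set"
  Obs :: "'p set"
  Ext :: "'p \<Rightarrow> 's set"

definition transition_system :: "('s, 'p) ts \<Rightarrow> bool" where
  "transition_system S \<longleftrightarrow>
     (\<forall>s\<in>States S. Succ S s \<subseteq> States S) \<and> finite (Obs S) \<and> (\<forall>p\<in>Obs S. Ext S p \<subseteq> States S)"

datatype ('p, 'h) mu =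
    Atom 'p
  | NegAtom 'p
  | Var 'h
  | Disj "('p, 'h) mu" "('p, 'h) mu"
  | Conj "('p, 'h) mu" "('p, 'h) mu"
  | EX_next "('p, 'h) mu"
  | AX_next "('p, 'h) mu"
  | Mu 'h "('p, 'h) mu"
  | Nu 'h "('p, 'h) mu"

primrec sem :: "('s, 'p) ts \<Rightarrow> ('p, 'h) mu \<Rightarrow> ('h \<Rightarrow> 's set) \<Rightarrow> 's set" where
  "sem S (Atom p) E = Ext S p"
| "sem S (NegAtom p) E = States S - Ext S p"
| "sem S (Var h) E = E h"
| "sem S (Disj f g) E = sem S f E \<union> sem S g E"
| "sem S (Conj f g) E = sem S f E \<inter> sem S g E"
| "sem S (EX_next f) E = {s \<in> States S. \<exists>s'\<in>Succ S s. s' \<in> sem S f E}"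
| "sem S (AX_next f) E = {s \<in> States S. \<forall>s'\<in>Succ S s. s' \<in> sem S f E}"
| "sem S (Mu h f) E = \<Inter> {T. T \<subseteq> States S \<and> T = sem S f (E(h := T))}"
| "sem S (Nu h f) E = \<Union> {T. T \<subseteq> States S \<and> T = sem S f (E(h := T))}"

primrec free_vars :: "('p, 'h) mu \<Rightarrow> 'h set" where
  "free_vars (Atom p) = {}"
| "free_vars (NegAtom p) = {}"
| "free_vars (Var h) = {h}"
| "free_vars (Disj f g) = free_vars f \<union> free_vars g"
| "free_vars (Conj f g) = free_vars f \<union> free_vars g"
| "free_vars (EX_next f) = free_vars f"
| "free_vars (AX_next f) = free_vars f"
| "free_vars (Mu h f) = free_vars f - {h}"
| "free_vars (Nu h f) = free_vars f - {h}"

definition closed_formula :: "('p, 'h) mu \<Rightarrow> bool" where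
  "closed_formula f \<longleftrightarrow> free_vars f = {}"

lemma sem_cong_env:
  "(\<And>h. h \<in> free_vars f \<Longrightarrow> E h = E' h) \<Longrightarrow> sem S f E = sem S f E'"
proof (induction f arbitrary: E E')
  case (Disj f g)
  show ?case using Disj.IH[of E E'] Disj.prems by simp
next
  case (Conj f g)
  show ?case using Conj.IH[of E E'] Conj.prems by simp
next
  case (EX_next f)
  show ?case using EX_next.IH[of E E'] EX_next.prems by simp
next
  case (AX_next f)
  show ?case using AX_next.IH[of E E'] AX_next.prems by simp
next
  case (Mu h f)
  have "sem S f (E(h := T)) = sem S f (E'(h := T))" for T
    by (rule Mu.IH) (use Mu.prems in auto)
  then show ?case by simp
next
  case (Nu h f)
  have "sem S f (E(h := T)) = sem S f (E'(h := T))" for T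
    by (rule Nu.IH) (use Nu.prems in auto)
  then show ?case by simp
qed auto

text \<open>The environment is irrelevant for closed formulas, so satisfaction fixes an arbitrary one.\<close>

lemma sem_closed: "closed_formula f \<Longrightarrow> sem S f E = sem S f E'"
  by (rule sem_cong_env) (simp add: closed_formula_def)

definition sat :: "('s, 'p) ts \<Rightarrow> 's \<Rightarrow> ('p, 'h) mu \<Rightarrow> bool" where
  "sat S s f \<longleftrightarrow> s \<in> sem S f (\<lambda>_. {})"

definition sat_from :: "('s, 'p) ts \<Rightarrow> 'p \<Rightarrow> ('p, 'h) mu \<Rightarrow> bool" where
  "sat_from S b f \<longleftrightarrow> (\<forall>s\<in>Ext S b. sat S s f)"

primrec observables :: "('p, 'h) mu \<Rightarrow> 'p set" where
  "observables (Atom p) = {p}"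
| "observables (NegAtom p) = {p}"
| "observables (Var h) = {}"
| "observables (Disj f g) = observables f \<union> observables g"
| "observables (Conj f g) = observables f \<union> observables g"
| "observables (EX_next f) = observables f"
| "observables (AX_next f) = observables f"
| "observables (Mu h f) = observables f"
| "observables (Nu h f) = observables f"

primrec no_NegAtom_AX :: "('p, 'h) mu \<Rightarrow> bool" where
  "no_NegAtom_AX (Atom p) = True"
| "no_NegAtom_AX (NegAtom p) = False"
| "no_NegAtom_AX (Var h) = True"
| "no_NegAtom_AX (Disj f g) = (no_NegAtom_AX f \<and> no_NegAtom_AX g)"
| "no_NegAtom_AX (Conj f g) = (no_NegAtom_AX f \<and> no_NegAtom_AX g)"
| "no_NegAtom_AX (EX_next f) = no_NegAtom_AX f"
| "no_NegAtom_AX (AX_next f) = False"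
| "no_NegAtom_AX (Mu h f) = no_NegAtom_AX f"
| "no_NegAtom_AX (Nu h f) = no_NegAtom_AX f"

primrec no_Conj_Nu :: "('p, 'h) mu \<Rightarrow> bool" where
  "no_Conj_Nu (Atom p) = True"
| "no_Conj_Nu (NegAtom p) = True"
| "no_Conj_Nu (Var h) = True"
| "no_Conj_Nu (Disj f g) = (no_Conj_Nu f \<and> no_Conj_Nu g)"
| "no_Conj_Nu (Conj f g) = False"
| "no_Conj_Nu (EX_next f) = no_Conj_Nu f"
| "no_Conj_Nu (AX_next f) = no_Conj_Nu f"
| "no_Conj_Nu (Mu h f) = no_Conj_Nu f"
| "no_Conj_Nu (Nu h f) = False"

text \<open>In \<open>L2\<close> and \<open>L4\<close>, the argument \<open>V\<close> is the set of observables that may occur.\<close>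

definition L2 :: "'p set \<Rightarrow> ('p, 'h) mu set" where
  "L2 V = {f. closed_formula f \<and> observables f \<subseteq> V \<and> no_NegAtom_AX f}"

definition L4 :: "'p set \<Rightarrow> ('p, 'h) mu set" where
  "L4 V = {f \<in> L2 V. no_Conj_Nu f}"

primrec dual :: "('p, 'h) mu \<Rightarrow> ('p, 'h) mu" where
  "dual (Atom p) = NegAtom p"
| "dual (NegAtom p) = Atom p"
| "dual (Var h) = Var h"
| "dual (Disj f g) = Conj (dual f) (dual g)"
| "dual (Conj f g) = Disj (dual f) (dual g)"
| "dual (EX_next f) = AX_next (dual f)"
| "dual (AX_next f) = EX_next (dual f)"
| "dual (Mu h f) = Nu h (dual f)"
| "dual (Nu h f) = Mu h (dual f)"

definition dual_logic :: "('p, 'h) mu set \<Rightarrow> ('p, 'h) mu set" where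
  "dual_logic L = dual ` L"


section \<open>Programs\<close>

text \<open>
  The four kinds of variables have names in the separate types \<open>'b\<close> (boolean), \<open>'x\<close> (of type X),
  \<open>'y\<close> (of type Y) and \<open>'a\<close> (arrays from X to Y).
\<close>

datatype ('b, 'x, 'y) bexp =
    BTrue
  | BFalse
  | BVar 'b
  | XEq 'x 'x
  | YEq 'y 'y
  | BNot "('b, 'x, 'y) bexp"
  | BOr "('b, 'x, 'y) bexp" "('b, 'x, 'y) bexp"

datatype 'x xrhs = XCopy 'x | XChoose

datatype ('x, 'y, 'a) yrhs = YCopy 'y | YChoose | YRead 'a 'x

text \<open>
  A command consists of at most one assignment per variable, hence partial maps from left-hand
  sides to right-hand sides; \<open>ArrAsg I a = Some (x, y)\<close> stands for the write \<open>a[x] := y\<close>.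
\<close>

record ('b, 'x, 'y, 'a) command =
  BoolAsg :: "'b \<rightharpoonup> ('b, 'x, 'y) bexp"
  XAsg :: "'x \<rightharpoonup> 'x xrhs"
  YAsg :: "'y \<rightharpoonup> ('x, 'y, 'a) yrhs"
  ArrAsg :: "'a \<rightharpoonup> 'x \<times> 'y"

record ('b, 'x, 'y, 'a) program =
  BoolVars :: "'b set"
  XVars :: "'x set"
  YVars :: "'y set"
  Arrays :: "'a set"
  Cmds :: "(('b, 'x, 'y) bexp \<times> ('b, 'x, 'y, 'a) command) set"

primrec wf_bexp :: "('b, 'x, 'y, 'a) program \<Rightarrow> ('b, 'x, 'y) bexp \<Rightarrow> bool" where
  "wf_bexp P BTrue = True"
| "wf_bexp P BFalse = True"
| "wf_bexp P (BVar b) = (b \<in> BoolVars P)"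
| "wf_bexp P (XEq x x') = (x \<in> XVars P \<and> x' \<in> XVars P)"
| "wf_bexp P (YEq y y') = (y \<in> YVars P \<and> y' \<in> YVars P)"
| "wf_bexp P (BNot e) = wf_bexp P e"
| "wf_bexp P (BOr e e') = (wf_bexp P e \<and> wf_bexp P e')"

primrec wf_xrhs :: "('b, 'x, 'y, 'a) program \<Rightarrow> 'x xrhs \<Rightarrow> bool" where
  "wf_xrhs P (XCopy x) = (x \<in> XVars P)"
| "wf_xrhs P XChoose = True"

primrec wf_yrhs :: "('b, 'x, 'y, 'a) program \<Rightarrow> ('x, 'y, 'a) yrhs \<Rightarrow> bool" where
  "wf_yrhs P (YCopy y) = (y \<in> YVars P)"
| "wf_yrhs P YChoose = True"
| "wf_yrhs P (YRead a x) = (a \<in> Arrays P \<and> x \<in> XVars P)"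

definition wf_command ::
  "('b, 'x, 'y, 'a) program \<Rightarrow> ('b, 'x, 'y, 'a) command \<Rightarrow> bool" where
  "wf_command P I \<longleftrightarrow>
     (\<forall>b e. BoolAsg I b = Some e \<longrightarrow> b \<in> BoolVars P \<and> wf_bexp P e) \<and>
     (\<forall>x r. XAsg I x = Some r \<longrightarrow> x \<in> XVars P \<and> wf_xrhs P r) \<and>
     (\<forall>y r. YAsg I y = Some r \<longrightarrow> y \<in> YVars P \<and> wf_yrhs P r) \<and>
     (\<forall>a x y. ArrAsg I a = Some (x, y) \<longrightarrow> a \<in> Arrays P \<and> x \<in> XVars P \<and> y \<in> YVars P)"

definition wf_program :: "('b, 'x, 'y, 'a) program \<Rightarrow> bool" where
  "wf_program P \<longleftrightarrow>
     finite (BoolVars P) \<and> finite (XVars P) \<and> finite (YVars P) \<and> finite (Arrays P) \<and>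
     finite (Cmds P) \<and> (\<forall>(e, I)\<in>Cmds P. wf_bexp P e \<and> wf_command P I)"


section \<open>Semantics of programs\<close>

text \<open>
  One type of states serves both semantics: an array is mapped to a partial function, which in the
  normal semantics has domain exactly \<open>A\<close>. Undefinedness is \<open>None\<close>. The components are
  extensional, so a state carries no information about names that are not variables of \<open>P\<close>.
\<close>

record ('b, 'x, 'y, 'a, 'u, 'v) state =
  bval :: "'b \<Rightarrow> bool"
  xval :: "'x \<Rightarrow> 'u"
  yval :: "'y \<Rightarrow> 'v"
  aval :: "'a \<Rightarrow> 'u \<rightharpoonup> 'v"

primrec beval :: "('b, 'x, 'y, 'a, 'u, 'v) state \<Rightarrow> ('b, 'x, 'y) bexp \<Rightarrow> bool" where
  "beval s BTrue = True"
| "beval s BFalse = False"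
| "beval s (BVar b) = bval s b"
| "beval s (XEq x x') = (xval s x = xval s x')"
| "beval s (YEq y y') = (yval s y = yval s y')"
| "beval s (BNot e) = (\<not> beval s e)"
| "beval s (BOr e e') = (beval s e \<or> beval s e')"

definition states_normal ::
  "('b, 'x, 'y, 'a) program \<Rightarrow> 'u set \<Rightarrow> 'v set \<Rightarrow> ('b, 'x, 'y, 'a, 'u, 'v) state set" where
  "states_normal P A B = {s.
     bval s \<in> BoolVars P \<rightarrow>\<^sub>E UNIV \<and>
     xval s \<in> XVars P \<rightarrow>\<^sub>E A \<and>
     yval s \<in> YVars P \<rightarrow>\<^sub>E B \<and>
     aval s \<in> Arrays P \<rightarrow>\<^sub>E {f. dom f = A \<and> ran f \<subseteq> B}}"

definition states_partial ::
  "('b, 'x, 'y, 'a) program \<Rightarrow> 'u set \<Rightarrow> 'v set \<Rightarrow> ('b, 'x, 'y, 'a, 'u, 'v) state set" where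
  "states_partial P A B = {s.
     bval s \<in> BoolVars P \<rightarrow>\<^sub>E UNIV \<and>
     xval s \<in> XVars P \<rightarrow>\<^sub>E A \<and>
     yval s \<in> YVars P \<rightarrow>\<^sub>E B \<and>
     aval s \<in> Arrays P \<rightarrow>\<^sub>E
       {f. finite (dom f) \<and> dom f \<subseteq> A \<and> ran f \<subseteq> B \<and> (\<forall>x\<in>XVars P. xval s x \<in> dom f)}}"

text \<open>
  The two semantics share the updates of boolean and data variables. In a state of either semantics
  \<open>aval s a (xval s x)\<close> is not \<open>None\<close>, so a read assigns the value stored there.
\<close>

definition bool_step ::
  "('b, 'x, 'y, 'a) program \<Rightarrow> ('b, 'x, 'y, 'a) command \<Rightarrow>
   ('b, 'x, 'y, 'a, 'u, 'v) state \<Rightarrow> ('b, 'x, 'y, 'a, 'u, 'v) state \<Rightarrow> bool" where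
  "bool_step P I s s' \<longleftrightarrow>
     (\<forall>b\<in>BoolVars P. bval s' b = (case BoolAsg I b of Some e \<Rightarrow> beval s e | None \<Rightarrow> bval s b))"

definition data_step ::
  "('b, 'x, 'y, 'a) program \<Rightarrow> ('b, 'x, 'y, 'a) command \<Rightarrow>
   ('b, 'x, 'y, 'a, 'u, 'v) state \<Rightarrow> ('b, 'x, 'y, 'a, 'u, 'v) state \<Rightarrow> bool" where
  "data_step P I s s' \<longleftrightarrow>
     (\<forall>x\<in>XVars P. case XAsg I x of
         Some (XCopy x') \<Rightarrow> xval s' x = xval s x'
       | Some XChoose \<Rightarrow> True
       | None \<Rightarrow> xval s' x = xval s x) \<and>
     (\<forall>y\<in>YVars P. case YAsg I y of
         Some (YCopy y') \<Rightarrow> yval s' y = yval s y'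
       | Some (YRead a x) \<Rightarrow> Some (yval s' y) = aval s a (xval s x)
       | Some YChoose \<Rightarrow> True
       | None \<Rightarrow> yval s' y = yval s y)"

text \<open>The value that \<open>I\<close> writes to array \<open>a\<close> at position \<open>v\<close> in state \<open>s\<close>, if any.\<close>

definition written ::
  "('b, 'x, 'y, 'a) command \<Rightarrow> ('b, 'x, 'y, 'a, 'u, 'v) state \<Rightarrow> 'a \<Rightarrow> 'u \<Rightarrow> 'v option" where
  "written I s a v = (case ArrAsg I a of
       Some (x, y) \<Rightarrow> if xval s x = v then Some (yval s y) else None
     | None \<Rightarrow> None)"

definition array_step_normal ::
  "('b, 'x, 'y, 'a) program \<Rightarrow> 'u set \<Rightarrow> ('b, 'x, 'y, 'a) command \<Rightarrow>
   ('b, 'x, 'y, 'a, 'u, 'v) state \<Rightarrow> ('b, 'x, 'y, 'a, 'u, 'v) state \<Rightarrow> bool" where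
  "array_step_normal P A I s s' \<longleftrightarrow>
     (\<forall>a\<in>Arrays P. \<forall>v\<in>A. case written I s a v of
         Some w \<Rightarrow> aval s' a v = Some w
       | None \<Rightarrow> aval s' a v = aval s a v)"

text \<open>
  An undefined position that becomes the nondeterministically chosen value of some X-variable may
  receive any value; that it becomes defined is enforced by the successor being a state.
\<close>

definition array_step_partial ::
  "('b, 'x, 'y, 'a) program \<Rightarrow> 'u set \<Rightarrow> ('b, 'x, 'y, 'a) command \<Rightarrow>
   ('b, 'x, 'y, 'a, 'u, 'v) state \<Rightarrow> ('b, 'x, 'y, 'a, 'u, 'v) state \<Rightarrow> bool" where
  "array_step_partial P A I s s' \<longleftrightarrow>
     (\<forall>a\<in>Arrays P. \<forall>v\<in>A. case written I s a v of
         Some w \<Rightarrow> aval s' a v = Some w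
       | None \<Rightarrow>
           \<not> (\<exists>x\<in>XVars P. XAsg I x = Some XChoose \<and> xval s' x = v \<and> aval s a v = None)
             \<longrightarrow> aval s' a v = aval s a v)"

definition normal_ts ::
  "('b, 'x, 'y, 'a) program \<Rightarrow> 'u set \<Rightarrow> 'v set \<Rightarrow> (('b, 'x, 'y, 'a, 'u, 'v) state, 'b) ts" where
  "normal_ts P A B = \<lparr>
     States = states_normal P A B,
     Succ = (\<lambda>s. {s' \<in> states_normal P A B. \<exists>(e, I)\<in>Cmds P.
        beval s e \<and> bool_step P I s s' \<and> data_step P I s s' \<and> array_step_normal P A I s s'}),
     Obs = BoolVars P,
     Ext = (\<lambda>b. {s \<in> states_normal P A B. bval s b})\<rparr>"

definition partial_ts ::
  "('b, 'x, 'y, 'a) program \<Rightarrow> 'u set \<Rightarrow> 'v set \<Rightarrow> (('b, 'x, 'y, 'a, 'u, 'v) state, 'b) ts" where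
  "partial_ts P A B = \<lparr>
     States = states_partial P A B,
     Succ = (\<lambda>s. {s' \<in> states_partial P A B. \<exists>(e, I)\<in>Cmds P.
        beval s e \<and> bool_step P I s s' \<and> data_step P I s s' \<and> array_step_partial P A I s s'}),
     Obs = BoolVars P,
     Ext = (\<lambda>b. {s \<in> states_partial P A B. bval s b})\<rparr>"

lemma transition_system_normal_ts: "wf_program P \<Longrightarrow> transition_system (normal_ts P A B)"
  by (auto simp: wf_program_def transition_system_def normal_ts_def)

lemma transition_system_partial_ts: "wf_program P \<Longrightarrow> transition_system (partial_ts P A B)"
  by (auto simp: wf_program_def transition_system_def partial_ts_def)

end

theory Submission
  imports Defs
begin

text \<open>
  For finite \<open>A\<close>, the normal semantics over \<open>A\<close> and \<open>B\<close> is a subsystem of the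
  partial-functions semantics, so every existential formula true in the former is true in the latter.

  Conversely, a formula without conjunction and greatest fixpoint is witnessed by a finite run, along
  which the domains of the arrays only grow. Going backwards along the run, every entry that is still
  undefined is filled with the value it has in the total state chosen for the successor, which turns
  it into a run of the normal semantics. The induction over formulas compares the partial-functions
  semantics with the normal semantics for all sufficiently large finite \<open>A\<close> and \<open>B\<close>
  at once; in this form the run need not be made explicit.
\<close>

section \<open>Fixpoints in the mu-calculus\<close>

text \<open>The semantics of fixpoint formulas quantifies over subsets of the state space, whereas
  \<open>lfp\<close> and \<open>gfp\<close> live on all sets of the type. Cutting the argument down
  to \<open>Q\<close> makes the operator monotone everywhere.\<close>

lemma relative_mono:
  fixes F :: "'s set \<Rightarrow> 's set"
  assumes "mono_on (Pow Q) F"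
  shows "mono (\<lambda>T. F (T \<inter> Q))"
  by (rule monoI, rule mono_onD[OF assms]) auto

text \<open>Knaster-Tarski for exact fixpoints instead of prefixpoints: the values of
  \<open>F\<close> lie in \<open>Q\<close>, so the least fixpoint is itself one of the intersected
  sets.\<close>

lemma Inter_fixpoints_eq_lfp:
  fixes F :: "'s set \<Rightarrow> 's set"
  assumes mono: "mono_on (Pow Q) F" and range: "F \<in> Pow Q \<rightarrow> Pow Q"
  shows "\<Inter>{T. T \<subseteq> Q \<and> T = F T} = lfp (\<lambda>T. F (T \<inter> Q))" (is "_ = ?L")
proof -
  have unfold: "?L = F (?L \<inter> Q)"
    using lfp_unfold[OF relative_mono[OF mono]] .
  with range have "?L \<subseteq> Q" by blast
  with unfold have "?L \<in> {T. T \<subseteq> Q \<and> T = F T}"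
    by (simp add: Int_absorb2)
  moreover have "?L \<subseteq> T" if "T \<subseteq> Q" "T = F T" for T
    using that by (intro lfp_lowerbound) (simp add: Int_absorb2)
  ultimately show ?thesis by blast
qed

lemma Union_fixpoints_eq_gfp:
  fixes F :: "'s set \<Rightarrow> 's set"
  assumes mono: "mono_on (Pow Q) F" and range: "F \<in> Pow Q \<rightarrow> Pow Q"
  shows "\<Union>{T. T \<subseteq> Q \<and> T = F T} = gfp (\<lambda>T. F (T \<inter> Q))" (is "_ = ?G")
proof -
  have unfold: "?G = F (?G \<inter> Q)"
    using gfp_unfold[OF relative_mono[OF mono]] .
  with range have "?G \<subseteq> Q" by blast
  with unfold have "?G \<in> {T. T \<subseteq> Q \<and> T = F T}"
    by (simp add: Int_absorb2)
  moreover have "T \<subseteq> ?G" if "T \<subseteq> Q" "T = F T" for T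
    using that by (intro gfp_upperbound) (simp add: Int_absorb2)
  ultimately show ?thesis by blast
qed

text \<open>The inclusion is assumed for every \<open>p\<close>, not only for observables, which
  saves tracking the atoms that a formula contains.\<close>

context
  fixes S :: "('s, 'p) ts"
  assumes Ext_subset: "\<And>p. Ext S p \<subseteq> States S"
begin

text \<open>Range and monotonicity go into one induction because the fixpoint cases need both for
  the body, in order to replace the defining intersection or union by \<open>lfp\<close> or
  \<open>gfp\<close>.\<close>

lemma sem_subset_mono:
  assumes "\<And>h. E h \<subseteq> E' h" and "\<And>h. E' h \<subseteq> States S"
  shows "sem S f E \<subseteq> States S \<and> sem S f E \<subseteq> sem S f E'"
  using assms
proof (induction f arbitrary: E E')
  case (Disj f g)
  show ?case using Disj.IH[of E E'] Disj.prems by auto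
next
  case (Conj f g)
  show ?case using Conj.IH[of E E'] Conj.prems by auto
next
  case (EX_next f)
  show ?case using EX_next.IH[of E E'] EX_next.prems by auto
next
  case (AX_next f)
  show ?case using AX_next.IH[of E E'] AX_next.prems by auto
next
  case (Mu h f)
  have E: "E k \<subseteq> States S" for k using Mu.prems by blast
  have *: "sem S f (D(h := T)) \<subseteq> States S \<and> sem S f (D(h := T)) \<subseteq> sem S f (D'(h := T'))"
    if "\<And>k. D k \<subseteq> D' k" "\<And>k. D' k \<subseteq> States S" "T \<subseteq> T'" "T' \<subseteq> States S" for D D' T T'
    using that by (intro Mu.IH) auto
  have eq: "sem S (Mu h f) D = lfp (\<lambda>T. sem S f (D(h := T \<inter> States S)))"
    if "\<And>k. D k \<subseteq> States S" for D
    using *[of D D] that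
    by (simp add: mono_on_def Pi_iff Inter_fixpoints_eq_lfp)
  have "sem S (Mu h f) E \<subseteq> States S"
    unfolding eq[OF E] by (rule lfp_lowerbound) (use *[of E E "States S" "States S"] E in simp)
  moreover have "sem S (Mu h f) E \<subseteq> sem S (Mu h f) E'"
    unfolding eq[OF E] eq[OF Mu.prems(2)] by (rule lfp_mono) (use * Mu.prems in simp)
  ultimately show ?case by blast
next
  case (Nu h f)
  have E: "E k \<subseteq> States S" for k using Nu.prems by blast
  have *: "sem S f (D(h := T)) \<subseteq> States S \<and> sem S f (D(h := T)) \<subseteq> sem S f (D'(h := T'))"
    if "\<And>k. D k \<subseteq> D' k" "\<And>k. D' k \<subseteq> States S" "T \<subseteq> T'" "T' \<subseteq> States S" for D D' T T'
    using that by (intro Nu.IH) auto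
  have eq: "sem S (Nu h f) D = gfp (\<lambda>T. sem S f (D(h := T \<inter> States S)))"
    if "\<And>k. D k \<subseteq> States S" for D
    using *[of D D] that
    by (simp add: mono_on_def Pi_iff Union_fixpoints_eq_gfp)
  have "sem S (Nu h f) E \<subseteq> States S" by auto
  moreover have "sem S (Nu h f) E \<subseteq> sem S (Nu h f) E'"
    unfolding eq[OF E] eq[OF Nu.prems(2)] by (rule gfp_mono) (use * Nu.prems in simp)
  ultimately show ?case by blast
qed (use Ext_subset in auto)

lemma sem_subset: "(\<And>h. E h \<subseteq> States S) \<Longrightarrow> sem S f E \<subseteq> States S"
  using sem_subset_mono[of E E] by blast

lemma mono_on_sem:
  assumes "\<And>h. E h \<subseteq> States S"
  shows "mono_on (Pow (States S)) (\<lambda>T. sem S f (E(h := T)))"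
  unfolding mono_on_def
  by (intro allI impI sem_subset_mono[THEN conjunct2]) (use assms in auto)

lemma sem_funcset:
  assumes "\<And>h. E h \<subseteq> States S"
  shows "(\<lambda>T. sem S f (E(h := T))) \<in> Pow (States S) \<rightarrow> Pow (States S)"
proof
  fix T assume "T \<in> Pow (States S)"
  with assms show "sem S f (E(h := T)) \<in> Pow (States S)"
    by (intro PowI sem_subset) simp
qed

lemma sem_Mu_eq_lfp:
  assumes "\<And>h. E h \<subseteq> States S"
  shows "sem S (Mu h f) E = lfp (\<lambda>T. sem S f (E(h := T \<inter> States S)))"
  by (simp add: Inter_fixpoints_eq_lfp mono_on_sem sem_funcset assms)

lemma sem_Nu_eq_gfp:
  assumes "\<And>h. E h \<subseteq> States S"
  shows "sem S (Nu h f) E = gfp (\<lambda>T. sem S f (E(h := T \<inter> States S)))"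
  by (simp add: Union_fixpoints_eq_gfp mono_on_sem sem_funcset assms)

lemma sem_Mu_unfold:
  assumes "\<And>h. E h \<subseteq> States S"
  shows "sem S (Mu h f) E = sem S f (E(h := sem S (Mu h f) E))"
  using lfp_unfold[OF relative_mono[OF mono_on_sem[where f=f and h=h, OF assms]]] sem_subset[OF assms, of "Mu h f"]
  by (simp only: sem_Mu_eq_lfp[OF assms] Int_absorb2)

lemma sem_Nu_unfold:
  assumes "\<And>h. E h \<subseteq> States S"
  shows "sem S (Nu h f) E = sem S f (E(h := sem S (Nu h f) E))"
  using gfp_unfold[OF relative_mono[OF mono_on_sem[where f=f and h=h, OF assms]]] sem_subset[OF assms, of "Nu h f"]
  by (simp only: sem_Nu_eq_gfp[OF assms] Int_absorb2)

text \<open>Park induction, in a form that accepts prefixpoints although the semantics intersects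
  exact fixpoints; \<open>sem_Nu_upperbound\<close> is its coinductive counterpart.\<close>

lemma sem_Mu_lowerbound:
  assumes "\<And>h. E h \<subseteq> States S" and "T \<subseteq> States S" and "sem S f (E(h := T)) \<subseteq> T"
  shows "sem S (Mu h f) E \<subseteq> T"
  unfolding sem_Mu_eq_lfp[OF assms(1)]
  by (rule lfp_lowerbound) (use assms(2,3) in \<open>simp add: Int_absorb2\<close>)

lemma sem_Nu_upperbound:
  assumes "\<And>h. E h \<subseteq> States S" and "T \<subseteq> States S" and "T \<subseteq> sem S f (E(h := T))"
  shows "T \<subseteq> sem S (Nu h f) E"
  unfolding sem_Nu_eq_gfp[OF assms(1)]
  by (rule gfp_upperbound) (use assms(2,3) in \<open>simp add: Int_absorb2\<close>)

section \<open>Duality as complementation\<close>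

text \<open>\<open>dual\<close> leaves variables alone, so the complement has to be taken in the
  environment. In the fixpoint cases complementation turns fixpoints of a body into fixpoints of its
  dual, and each inclusion is one use of induction or coinduction.\<close>

lemma sem_dual:
  assumes "\<And>s. s \<in> States S \<Longrightarrow> Succ S s \<subseteq> States S" and "\<And>h. E h \<subseteq> States S"
  shows "sem S (dual f) (\<lambda>h. States S - E h) = States S - sem S f E"
  using assms(2)
proof (induction f arbitrary: E)
  case (Disj f g)
  show ?case using Disj.IH[of E] Disj.prems by auto
next
  case (Conj f g)
  show ?case using Conj.IH[of E] Conj.prems by auto
next
  case (EX_next f)
  show ?case using EX_next.IH[of E] EX_next.prems assms(1) by fastforce
next
  case (AX_next f)
  show ?case using AX_next.IH[of E] AX_next.prems assms(1) by fastforce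
next
  case (Mu h f)
  let ?C = "\<lambda>E k. States S - E k"
  have C: "\<And>h. ?C E h \<subseteq> States S" by blast
  \<comment> \<open>The updated environment is again a complement, namely that of
    \<open>E(h := T)\<close>, so the induction hypothesis applies to it.\<close>
  have step: "sem S (dual f) ((?C E)(h := States S - T)) = States S - sem S f (E(h := T))"
    if "T \<subseteq> States S" for T
  proof -
    have "(?C E)(h := States S - T) = ?C (E(h := T))" by (simp add: fun_eq_iff)
    moreover have "\<And>k. (E(h := T)) k \<subseteq> States S" using Mu.prems that by simp
    ultimately show ?thesis by (simp only: Mu.IH)
  qed
  let ?M = "sem S (Mu h f) E" and ?N = "sem S (Nu h (dual f)) (?C E)"
  have N: "?N \<subseteq> States S" and M: "?M \<subseteq> States S"
    using sem_subset[of "?C E" "Nu h (dual f)"] sem_subset[of E "Mu h f"] Mu.prems by blast+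
  have "States S - ?M \<subseteq> ?N"
    using step[OF M] sem_Mu_unfold[of E h f] Mu.prems
    by (intro sem_Nu_upperbound) auto
  moreover have "?M \<subseteq> States S - ?N"
  proof (rule sem_Mu_lowerbound)
    have "States S - (States S - ?N) = ?N" using N by blast
    then have "?N = States S - sem S f (E(h := States S - ?N))"
      using step[of "States S - ?N"] sem_Nu_unfold[OF C, of h "dual f"] by simp
    moreover have "sem S f (E(h := States S - ?N)) \<subseteq> States S"
      using Mu.prems by (intro sem_subset) auto
    ultimately show "sem S f (E(h := States S - ?N)) \<subseteq> States S - ?N" by blast
  qed (use Mu.prems in auto)
  ultimately show ?case using M N by (simp only: dual.simps) blast
next
  case (Nu h f)
  let ?C = "\<lambda>E k. States S - E k"
  have C: "\<And>h. ?C E h \<subseteq> States S" by blast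
  have step: "sem S (dual f) ((?C E)(h := States S - T)) = States S - sem S f (E(h := T))"
    if "T \<subseteq> States S" for T
  proof -
    have "(?C E)(h := States S - T) = ?C (E(h := T))" by (simp add: fun_eq_iff)
    moreover have "\<And>k. (E(h := T)) k \<subseteq> States S" using Nu.prems that by simp
    ultimately show ?thesis by (simp only: Nu.IH)
  qed
  let ?N = "sem S (Nu h f) E" and ?M = "sem S (Mu h (dual f)) (?C E)"
  have N: "?N \<subseteq> States S" and M: "?M \<subseteq> States S"
    using sem_subset[of "?C E" "Mu h (dual f)"] sem_subset[of E "Nu h f"] Nu.prems by blast+
  have "?M \<subseteq> States S - ?N"
    using step[OF N] sem_Nu_unfold[of E h f] Nu.prems
    by (intro sem_Mu_lowerbound) auto
  moreover have "States S - ?M \<subseteq> ?N"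
  proof (rule sem_Nu_upperbound)
    have "States S - (States S - ?M) = ?M" using M by blast
    then have "?M = States S - sem S f (E(h := States S - ?M))"
      using step[of "States S - ?M"] sem_Mu_unfold[OF C, of h "dual f"] by simp
    then show "States S - ?M \<subseteq> sem S f (E(h := States S - ?M))" by blast
  qed (use Nu.prems in auto)
  ultimately show ?case using M N by (simp only: dual.simps) blast
qed (use Ext_subset in auto)

lemma free_vars_dual: "free_vars (dual f) = free_vars f"
  by (induction f) auto

lemma sat_dual:
  assumes "\<And>s. s \<in> States S \<Longrightarrow> Succ S s \<subseteq> States S"
    and "closed_formula f" and "s \<in> States S"
  shows "sat S s (dual f) \<longleftrightarrow> \<not> sat S s f"
proof -
  have "closed_formula (dual f)"
    using assms(2) by (simp add: closed_formula_def free_vars_dual)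
  \<comment> \<open>\<open>sat\<close> uses the empty environment, whose complement is the full one;
    closedness bridges the difference.\<close>
  then have "sem S (dual f) (\<lambda>_. {}) = sem S (dual f) (\<lambda>_. States S - {})"
    by (rule sem_closed)
  also have "\<dots> = States S - sem S f (\<lambda>_. {})"
    by (rule sem_dual[OF assms(1)]) simp_all
  finally show ?thesis using assms(3) by (simp add: sat_def)
qed

lemma sat_from_dual:
  assumes "\<And>s. s \<in> States S \<Longrightarrow> Succ S s \<subseteq> States S" and "closed_formula f"
  shows "sat_from S b (dual f) \<longleftrightarrow> (\<forall>s\<in>Ext S b. \<not> sat S s f)"
  using sat_dual[OF assms] Ext_subset by (auto simp: sat_from_def)

end

section \<open>Existential formulas in subsystems\<close>

text \<open>Negated atoms and universal successors are the only operators that can lose states when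
  states, extensions and transitions are added, and \<open>no_NegAtom_AX\<close> excludes
  both.\<close>

lemma sem_subsystem:
  assumes Ext: "\<And>p. Ext S p \<subseteq> States S" "\<And>p. Ext S' p \<subseteq> States S'"
    and sub: "States S \<subseteq> States S'" "\<And>p. Ext S p \<subseteq> Ext S' p"
      "\<And>s. s \<in> States S \<Longrightarrow> Succ S s \<subseteq> Succ S' s"
    and "no_NegAtom_AX f"
    and "\<And>h. E h \<subseteq> States S" and "\<And>h. E' h \<subseteq> States S'" and "\<And>h. E h \<subseteq> E' h"
  shows "sem S f E \<subseteq> sem S' f E'"
  using assms(6-)
proof (induction f arbitrary: E E')
  case (Disj f g)
  show ?case using Disj.IH[of E E'] Disj.prems by auto
next
  case (Conj f g)
  show ?case using Conj.IH[of E E'] Conj.prems by auto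
next
  case (EX_next f)
  show ?case using EX_next.IH[of E E'] EX_next.prems sub by fastforce
next
  case (Mu h f)
  let ?T = "sem S' (Mu h f) E'"
  have T: "?T \<subseteq> States S'"
    using Mu.prems by (intro sem_subset Ext) auto
  \<comment> \<open>\<open>?T\<close> may contain states outside the smaller system, so its trace
    there serves as the prefixpoint.\<close>
  have "sem S (Mu h f) E \<subseteq> ?T \<inter> States S"
  proof (rule sem_Mu_lowerbound[OF Ext(1)])
    have "sem S f (E(h := ?T \<inter> States S)) \<subseteq> sem S' f (E'(h := ?T))"
      using Mu.prems T by (intro Mu.IH) auto
    also have "\<dots> = ?T"
      using sem_Mu_unfold[OF Ext(2), of E'] Mu.prems by blast
    finally show "sem S f (E(h := ?T \<inter> States S)) \<subseteq> ?T \<inter> States S"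
      using sem_subset[OF Ext(1), of "E(h := ?T \<inter> States S)" f] Mu.prems by auto
  qed (use Mu.prems in auto)
  then show ?case by blast
next
  case (Nu h f)
  let ?T = "sem S (Nu h f) E"
  have T: "?T \<subseteq> States S"
    using Nu.prems by (intro sem_subset Ext) auto
  show ?case
  \<comment> \<open>The greatest fixpoint of the smaller system is a postfixpoint in the larger one,
    so coinduction applies without any restriction.\<close>
  proof (rule sem_Nu_upperbound[OF Ext(2)])
    have "?T = sem S f (E(h := ?T))"
      using sem_Nu_unfold[OF Ext(1), of E] Nu.prems by blast
    also have "\<dots> \<subseteq> sem S' f (E'(h := ?T))"
      using Nu.prems T sub(1) by (intro Nu.IH) auto
    finally show "?T \<subseteq> sem S' f (E'(h := ?T))" .
  qed (use Nu.prems T sub(1) in auto)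
qed (use sub in auto)


section \<open>From the normal to the partial-functions semantics\<close>

lemma Ext_normal_subset: "Ext (normal_ts P A B) p \<subseteq> States (normal_ts P A B)"
  by (auto simp: normal_ts_def)

lemma Succ_normal_subset: "Succ (normal_ts P A B) s \<subseteq> States (normal_ts P A B)"
  by (auto simp: normal_ts_def)

lemma Succ_partial_subset: "Succ (partial_ts P A B) s \<subseteq> States (partial_ts P A B)"
  by (auto simp: partial_ts_def)

lemma Ext_partial_subset: "Ext (partial_ts P A B) p \<subseteq> States (partial_ts P A B)"
  by (auto simp: partial_ts_def)

lemma states_normal_subset_partial:
  assumes "finite A" "A \<subseteq> A'" "B \<subseteq> B'"
  shows "states_normal P A B \<subseteq> states_partial P A' B'"
  using assms by (fastforce simp: states_normal_def states_partial_def PiE_iff)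

text \<open>On \<open>A\<close> the normal condition is the stronger one. Outside \<open>A\<close>
  both states are undefined and nothing is written, because an index written to is the value of an
  X-variable and hence lies in \<open>A\<close>.\<close>

lemma array_step_normal_imp_partial:
  assumes "wf_command P I" "s \<in> states_normal P A B" "s' \<in> states_normal P A B"
    and step: "array_step_normal P A I s s'"
  shows "array_step_partial P A' I s s'"
  unfolding array_step_partial_def
proof (intro ballI)
  fix a v assume a: "a \<in> Arrays P"
  show "case written I s a v of
         Some w \<Rightarrow> aval s' a v = Some w
       | None \<Rightarrow>
           \<not> (\<exists>x\<in>XVars P. XAsg I x = Some XChoose \<and> xval s' x = v \<and> aval s a v = None)
             \<longrightarrow> aval s' a v = aval s a v"
  proof (cases "v \<in> A")
    case True
    with step a have "case written I s a v of
         Some w \<Rightarrow> aval s' a v = Some w | None \<Rightarrow> aval s' a v = aval s a v"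
      unfolding array_step_normal_def by blast
    then show ?thesis by (auto split: option.splits)
  next
    case False
    then have "written I s a v = None"
      using assms(1,2) by (fastforce simp: written_def wf_command_def states_normal_def split: option.splits)
    moreover have "aval s a v = None" "aval s' a v = None"
      using False a assms(2,3) by (auto simp: states_normal_def PiE_iff)
    ultimately show ?thesis by simp
  qed
qed

lemma sat_normal_imp_partial:
  assumes "wf_program P" "finite A" "A \<subseteq> A'" "B \<subseteq> B'" "no_NegAtom_AX f"
    and "sat (normal_ts P A B) s f"
  shows "sat (partial_ts P A' B') s f"
proof -
  have "sem (normal_ts P A B) f (\<lambda>_. {}) \<subseteq> sem (partial_ts P A' B') f (\<lambda>_. {})"
  proof (rule sem_subsystem[OF Ext_normal_subset Ext_partial_subset])
    fix s assume s: "s \<in> States (normal_ts P A B)"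
    show "Succ (normal_ts P A B) s \<subseteq> Succ (partial_ts P A' B') s"
    proof
      fix s' assume "s' \<in> Succ (normal_ts P A B) s"
      then obtain e I where I: "(e, I) \<in> Cmds P" "s' \<in> states_normal P A B"
        "beval s e" "bool_step P I s s'" "data_step P I s s'" "array_step_normal P A I s s'"
        by (auto simp: normal_ts_def)
      have "wf_command P I" using assms(1) I(1) by (auto simp: wf_program_def)
      then have "array_step_partial P A' I s s'"
        using array_step_normal_imp_partial I(2,6) s by (auto simp: normal_ts_def)
      then show "s' \<in> Succ (partial_ts P A' B') s"
        using I states_normal_subset_partial[OF assms(2-4)] by (auto simp: partial_ts_def)
    qed
  qed (use states_normal_subset_partial[OF assms(2-4), of P] assms(5) in
      \<open>auto simp: normal_ts_def partial_ts_def\<close>)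
  with assms(6) show ?thesis by (auto simp: sat_def)
qed


section \<open>Completing partial runs\<close>

definition extends ::
  "('b, 'x, 'y, 'a) program \<Rightarrow> ('b, 'x, 'y, 'a, 'u, 'v) state \<Rightarrow>
   ('b, 'x, 'y, 'a, 'u, 'v) state \<Rightarrow> bool" where
  "extends P t s \<longleftrightarrow> bval t = bval s \<and> xval t = xval s \<and> yval t = yval s \<and>
     (\<forall>a\<in>Arrays P. aval s a \<subseteq>\<^sub>m aval t a)"

lemma beval_cong:
  "bval s = bval t \<Longrightarrow> xval s = xval t \<Longrightarrow> yval s = yval t \<Longrightarrow> beval s e = beval t e"
  by (induction e) auto

text \<open>What \<open>A\<close> and \<open>B\<close> must contain for \<open>s\<close> to have a
  completion in the normal semantics over them.\<close>

definition supported ::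
  "('b, 'x, 'y, 'a) program \<Rightarrow> ('b, 'x, 'y, 'a, 'u, 'v) state \<Rightarrow> 'u set \<Rightarrow> 'v set \<Rightarrow> bool" where
  "supported P s A B \<longleftrightarrow> xval s ` XVars P \<subseteq> A \<and> yval s ` YVars P \<subseteq> B \<and>
     (\<forall>a\<in>Arrays P. dom (aval s a) \<subseteq> A \<and> ran (aval s a) \<subseteq> B)"

text \<open>\<open>m\<close> supplies default entries only: in \<open>++\<close> the right operand
  wins, so everything defined in \<open>s\<close> is kept. \<open>restrict\<close> keeps the array
  component extensional.\<close>

definition complete_state ::
  "('b, 'x, 'y, 'a) program \<Rightarrow> ('a \<Rightarrow> 'u \<rightharpoonup> 'v) \<Rightarrow>
   ('b, 'x, 'y, 'a, 'u, 'v) state \<Rightarrow> ('b, 'x, 'y, 'a, 'u, 'v) state" where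
  "complete_state P m s = s\<lparr>aval := restrict (\<lambda>a. m a ++ aval s a) (Arrays P)\<rparr>"

lemma complete_state_normal:
  assumes "s \<in> states_partial P A' B'" and "supported P s A B"
    and "\<And>a. a \<in> Arrays P \<Longrightarrow> dom (m a) = A \<and> ran (m a) \<subseteq> B"
  shows "complete_state P m s \<in> states_normal P A B"
proof -
  have "ran (m a ++ aval s a) \<subseteq> B" if "a \<in> Arrays P" for a
  proof -
    have "ran (aval s a) \<subseteq> B" "ran (m a) \<subseteq> B"
      using assms(2) assms(3)[OF that] that by (auto simp: supported_def)
    then show ?thesis by (auto simp: map_add_Some_iff subset_iff ran_def)
  qed
  moreover have "dom (m a ++ aval s a) = A" if "a \<in> Arrays P" for a
    using assms(2) assms(3)[OF that] that by (simp add: supported_def Un_absorb2 Un_commute)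
  moreover have "xval s \<in> XVars P \<rightarrow>\<^sub>E A" "yval s \<in> YVars P \<rightarrow>\<^sub>E B" "bval s \<in> BoolVars P \<rightarrow>\<^sub>E UNIV"
    using assms(1,2) by (auto simp: states_partial_def supported_def PiE_iff)
  ultimately show ?thesis
    by (simp add: states_normal_def complete_state_def PiE_iff)
qed

lemma extends_complete_state: "extends P (complete_state P m s) s"
  by (simp add: extends_def complete_state_def)

text \<open>
  The entries undefined in \<open>s\<close> are taken from \<open>t'\<close>: if such an entry stays undefined it does not
  change, and if it becomes defined then \<open>t'\<close> already holds its new value.
\<close>

lemma normal_step_complete_state:
  assumes wf: "wf_command P I"
    and s: "s \<in> states_partial P A' B'" "supported P s A B" "A \<subseteq> A'"
    and step: "bool_step P I s s'" "data_step P I s s'" "array_step_partial P A' I s s'"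
    and t': "t' \<in> states_normal P A B" "extends P t' s'"
  defines "t \<equiv> complete_state P (aval t') s"
  shows "t \<in> states_normal P A B" "bool_step P I t t'" "data_step P I t t'"
    "array_step_normal P A I t t'"
proof -
  have [simp]: "bval t = bval s" "xval t = xval s" "yval t = yval s"
    by (simp_all add: t_def complete_state_def)
  have [simp]: "bval t' = bval s'" "xval t' = xval s'" "yval t' = yval s'"
    using t'(2) by (simp_all add: extends_def)
  have aval_t: "aval t a = aval t' a ++ aval s a" if "a \<in> Arrays P" for a
    using that by (simp add: t_def complete_state_def)
  show "t \<in> states_normal P A B"
    unfolding t_def using s(1,2) t'(1)
    by (intro complete_state_normal) (auto simp: states_normal_def PiE_iff)
  have "beval t e = beval s e" for e by (rule beval_cong) simp_all
  then show "bool_step P I t t'" using step(1) by (simp add: bool_step_def split: option.splits)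
  \<comment> \<open>Partial arrays are defined at the values of all X-variables, so the filled-in
    entries never influence a read.\<close>
  have read: "aval t a (xval s x) = aval s a (xval s x)" if "a \<in> Arrays P" "x \<in> XVars P" for a x
  proof -
    have "xval s x \<in> dom (aval s a)"
      using that s(1) by (auto simp: states_partial_def PiE_iff)
    then show ?thesis using that(1) by (simp add: aval_t map_add_dom_app_simps(1))
  qed
  have read_t: "aval t a (xval s x) = aval s a (xval s x)" if "YAsg I y = Some (YRead a x)" for y a x
    using wf that by (intro read) (fastforce simp: wf_command_def)+
  show "data_step P I t t'"
    unfolding data_step_def
  proof (intro conjI ballI)
    fix x assume "x \<in> XVars P"
    with step(2) show "case XAsg I x of Some (XCopy x') \<Rightarrow> xval t' x = xval t x'
        | Some XChoose \<Rightarrow> True | None \<Rightarrow> xval t' x = xval t x"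
      unfolding data_step_def by (fastforce split: option.split xrhs.split)
  next
    fix y assume "y \<in> YVars P"
    with step(2) have "case YAsg I y of Some (YCopy y') \<Rightarrow> yval s' y = yval s y'
        | Some (YRead a x) \<Rightarrow> Some (yval s' y) = aval s a (xval s x)
        | Some YChoose \<Rightarrow> True | None \<Rightarrow> yval s' y = yval s y"
      unfolding data_step_def by blast
    then show "case YAsg I y of Some (YCopy y') \<Rightarrow> yval t' y = yval t y'
        | Some (YRead a x) \<Rightarrow> Some (yval t' y) = aval t a (xval t x)
        | Some YChoose \<Rightarrow> True | None \<Rightarrow> yval t' y = yval t y"
      by (simp add: read_t split: option.splits yrhs.splits)
  qed
  show "array_step_normal P A I t t'"
    unfolding array_step_normal_def
  proof (intro ballI)
    fix a v assume a: "a \<in> Arrays P" and v: "v \<in> A"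
    have written: "written I t a v = written I s a v"
      by (simp add: written_def split: option.split)
    have le: "aval t' a v = Some w" if "aval s' a v = Some w" for w
    proof -
      have "aval s' a \<subseteq>\<^sub>m aval t' a" using t'(2) a by (simp add: extends_def)
      then show ?thesis using that by (metis domI map_le_def)
    qed
    have v': "v \<in> A'" using v s(3) by blast
    show "case written I t a v of
         Some w \<Rightarrow> aval t' a v = Some w | None \<Rightarrow> aval t' a v = aval t a v"
    proof (cases "written I s a v")
      case None
      \<comment> \<open>The exception for newly chosen positions concerns undefined entries only; a
        defined entry that is not overwritten survives in \<open>s'\<close>, hence in
        \<open>t'\<close>. An undefined one agrees with \<open>t'\<close> by the choice of
        \<open>t\<close>.\<close>
      have "aval s' a v = Some w" if w: "aval s a v = Some w" for w
        using step(3) a v' None w by (fastforce simp: array_step_partial_def)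
      then show ?thesis
        using le None by (simp add: written aval_t[OF a] map_add_def split: option.split)
    next
      case (Some w)
      then have "aval s' a v = Some w"
        using step(3) a v' by (fastforce simp: array_step_partial_def)
      then show ?thesis using le Some by (simp add: written)
    qed
  qed
qed

section \<open>Sufficiently large finite instances\<close>

text \<open>With a filter, the demands that different states make on the size of an instance combine
  without explicit bounds.\<close>

abbreviation large_finite :: "'u set \<Rightarrow> 'v set \<Rightarrow> ('u set \<times> 'v set) filter" where
  "large_finite A B \<equiv> finite_subsets_at_top A \<times>\<^sub>F finite_subsets_at_top B"

lemma eventually_large_finite:
  assumes "finite C" "C \<subseteq> A" "finite D" "D \<subseteq> B"
  shows "\<forall>\<^sub>F (F, G) in large_finite A B. (finite F \<and> C \<subseteq> F \<and> F \<subseteq> A) \<and> (finite G \<and> D \<subseteq> G \<and> G \<subseteq> B)"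
  unfolding case_prod_beta
proof (rule eventually_prodI)
  show "\<forall>\<^sub>F F in finite_subsets_at_top A. finite F \<and> C \<subseteq> F \<and> F \<subseteq> A"
    using assms(1,2) unfolding eventually_finite_subsets_at_top by blast
  show "\<forall>\<^sub>F G in finite_subsets_at_top B. finite G \<and> D \<subseteq> G \<and> G \<subseteq> B"
    using assms(3,4) unfolding eventually_finite_subsets_at_top by blast
qed

text \<open>A state mentions finitely many values only: the program has finitely many variables, and
  each array has a finite domain and therefore a finite range.\<close>

lemma eventually_supported:
  assumes "wf_program P" "s \<in> states_partial P A B"
  shows "\<forall>\<^sub>F (F, G) in large_finite A B. supported P s F G \<and> F \<subseteq> A"
proof -
  let ?C = "xval s ` XVars P \<union> (\<Union>a\<in>Arrays P. dom (aval s a))"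
  let ?D = "yval s ` YVars P \<union> (\<Union>a\<in>Arrays P. ran (aval s a))"
  have fin: "finite (XVars P)" "finite (YVars P)" "finite (Arrays P)"
    using assms(1) by (auto simp: wf_program_def)
  have s: "xval s \<in> XVars P \<rightarrow> A" "yval s \<in> YVars P \<rightarrow> B"
    "\<And>a. a \<in> Arrays P \<Longrightarrow> finite (dom (aval s a)) \<and> dom (aval s a) \<subseteq> A \<and> ran (aval s a) \<subseteq> B"
    using assms(2) by (auto simp: states_partial_def PiE_iff)
  have "finite ?C" "?C \<subseteq> A" using fin s by blast+
  moreover have "finite ?D" "?D \<subseteq> B" using fin s by (blast intro: finite_ran)+
  ultimately show ?thesis
    by (rule eventually_mono[OF eventually_large_finite]) (force simp: supported_def)
qed

text \<open>\<open>T\<close> is a family because a formula denotes a different state set in each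
  finite instance. The completion may depend on the instance.\<close>

definition completable ::
  "('b, 'x, 'y, 'a) program \<Rightarrow> 'u set \<Rightarrow> 'v set \<Rightarrow>
   ('u set \<Rightarrow> 'v set \<Rightarrow> ('b, 'x, 'y, 'a, 'u, 'v) state set) \<Rightarrow> ('b, 'x, 'y, 'a, 'u, 'v) state set" where
  "completable P A B T = {s \<in> states_partial P A B.
     \<forall>\<^sub>F (F, G) in large_finite A B. \<exists>t\<in>T F G. extends P t s}"

lemma completable_mono:
  assumes "\<And>F G. T F G \<subseteq> T' F G"
  shows "completable P A B T \<subseteq> completable P A B T'"
  unfolding completable_def
  by (rule Collect_mono) (use assms in \<open>auto elim!: eventually_mono\<close>)

text \<open>Each operator of the fragment asks for one completion at a time, whereas two conjuncts
  could be witnessed by different completions of the same state. Variables denote different sets in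
  different instances, hence the family of environments \<open>N\<close>.\<close>

lemma sem_partial_subset_completable:
  assumes wf: "wf_program P" and B: "B \<noteq> {}"
    and "no_NegAtom_AX f" "no_Conj_Nu f"
    and "\<And>h. E h \<subseteq> completable P A B (\<lambda>F G. N F G h)"
    and "\<And>F G h. N F G h \<subseteq> states_normal P F G"
  shows "sem (partial_ts P A B) f E \<subseteq> completable P A B (\<lambda>F G. sem (normal_ts P F G) f (N F G))"
  using assms(3-)
proof (induction f arbitrary: E N)
  case (Atom b)
  show ?case
  proof
    fix s assume "s \<in> sem (partial_ts P A B) (Atom b) E"
    then have s: "s \<in> states_partial P A B" "bval s b" by (auto simp: partial_ts_def)
    \<comment> \<open>For an atom no successor supplies values, so a constant \<open>w\<close> fills
      the missing entries; large instances contain it.\<close>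
    obtain w where w: "w \<in> B" using B by blast
    have "\<forall>\<^sub>F (F, G) in large_finite A B. (finite F \<and> {} \<subseteq> F \<and> F \<subseteq> A) \<and> (finite G \<and> {w} \<subseteq> G \<and> G \<subseteq> B)"
      using w by (intro eventually_large_finite) auto
    with eventually_supported[OF wf s(1)]
    have "\<forall>\<^sub>F (F, G) in large_finite A B. \<exists>t\<in>sem (normal_ts P F G) (Atom b) (N F G). extends P t s"
    proof eventually_elim
      case (elim FG)
      obtain F G where FG: "FG = (F, G)" by force
      let ?m = "\<lambda>_ v. if v \<in> F then Some w else None"
      have "complete_state P ?m s \<in> states_normal P F G"
        using elim FG by (intro complete_state_normal[OF s(1)]) (auto simp: ran_def dom_def)
      then show ?case
        using extends_complete_state[of P ?m s] s(2) FG
        by (auto simp: normal_ts_def extends_def)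
    qed
    with s(1) show "s \<in> completable P A B (\<lambda>F G. sem (normal_ts P F G) (Atom b) (N F G))"
      by (simp add: completable_def)
  qed
next
  case (Disj f g)
  have "sem (partial_ts P A B) f E \<subseteq> completable P A B (\<lambda>F G. sem (normal_ts P F G) f (N F G))"
    "sem (partial_ts P A B) g E \<subseteq> completable P A B (\<lambda>F G. sem (normal_ts P F G) g (N F G))"
    using Disj by auto
  moreover have "completable P A B (\<lambda>F G. sem (normal_ts P F G) k (N F G))
      \<subseteq> completable P A B (\<lambda>F G. sem (normal_ts P F G) (Disj f g) (N F G))" if "k \<in> {f, g}" for k
    using that by (intro completable_mono) auto
  ultimately show ?case by auto
next
  case (EX_next f)
  have IH: "sem (partial_ts P A B) f E \<subseteq> completable P A B (\<lambda>F G. sem (normal_ts P F G) f (N F G))"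
    using EX_next by auto
  show ?case
  proof
    fix s assume "s \<in> sem (partial_ts P A B) (EX_next f) E"
    then obtain s' e I where s: "s \<in> states_partial P A B" and s': "s' \<in> sem (partial_ts P A B) f E"
      and I: "(e, I) \<in> Cmds P" "beval s e"
        "bool_step P I s s'" "data_step P I s s'" "array_step_partial P A I s s'"
      by (auto simp: partial_ts_def)
    have wfI: "wf_command P I" using wf I(1) by (auto simp: wf_program_def)
    have "\<forall>\<^sub>F (F, G) in large_finite A B. \<exists>t\<in>sem (normal_ts P F G) f (N F G). extends P t s'"
      using IH s' by (auto simp: completable_def)
    \<comment> \<open>The successor \<open>s'\<close> is fixed before the instance is chosen; large
      instances both complete \<open>s'\<close> and support \<open>s\<close>.\<close>
    with eventually_supported[OF wf s]
    have "\<forall>\<^sub>F (F, G) in large_finite A B.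
      \<exists>t\<in>sem (normal_ts P F G) (EX_next f) (N F G). extends P t s"
    proof eventually_elim
      case (elim FG)
      obtain F G where FG: "FG = (F, G)" by force
      with elim obtain t' where t': "t' \<in> sem (normal_ts P F G) f (N F G)" "extends P t' s'"
        and sup: "supported P s F G" "F \<subseteq> A" by auto
      have "sem (normal_ts P F G) f (N F G) \<subseteq> States (normal_ts P F G)"
        using EX_next.prems(4) by (intro sem_subset Ext_normal_subset) (auto simp: normal_ts_def)
      with t'(1) have t'_normal: "t' \<in> states_normal P F G" by (auto simp: normal_ts_def)
      define t where "t = complete_state P (aval t') s"
      have ext: "extends P t s" unfolding t_def by (rule extends_complete_state)
      then have "beval t e" using I(2) beval_cong[of t s e] by (simp add: extends_def)
      moreover note normal_step_complete_state[OF wfI s sup I(3-5) t'_normal t'(2), folded t_def]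
      ultimately have "t \<in> sem (normal_ts P F G) (EX_next f) (N F G)"
        using I(1) t'(1) t'_normal by (auto simp: normal_ts_def)
      then show ?case using ext FG by auto
    qed
    with s show "s \<in> completable P A B (\<lambda>F G. sem (normal_ts P F G) (EX_next f) (N F G))"
      by (simp add: completable_def)
  qed
next
  case (Mu h f)
  define M where "M F G = sem (normal_ts P F G) (Mu h f) (N F G)" for F G
  have N: "N F G k \<subseteq> States (normal_ts P F G)" for F G k
    using Mu.prems(4) by (simp add: normal_ts_def)
  have M_eq: "M F G = sem (normal_ts P F G) f ((N F G)(h := M F G))" for F G
    unfolding M_def by (rule sem_Mu_unfold[OF Ext_normal_subset N])
  have M_sub: "M F G \<subseteq> states_normal P F G" for F G
    using sem_subset[OF Ext_normal_subset N, of F G "Mu h f"] by (simp add: M_def normal_ts_def)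
  \<comment> \<open>\<open>M\<close> collects the least fixpoints of all instances. Since each of
    them unfolds, the induction hypothesis makes \<open>?T\<close> a prefixpoint in the
    partial-functions semantics, and Park induction applies.\<close>
  let ?T = "completable P A B M"
  have "sem (partial_ts P A B) f (E(h := ?T))
      \<subseteq> completable P A B (\<lambda>F G. sem (normal_ts P F G) f ((N F G)(h := M F G)))"
    using Mu.prems M_sub by (intro Mu.IH) auto
  then have "sem (partial_ts P A B) f (E(h := ?T)) \<subseteq> ?T"
    by (simp flip: M_eq)
  moreover have "E k \<subseteq> States (partial_ts P A B)" for k
    using Mu.prems(3)[of k] by (auto simp: completable_def partial_ts_def)
  moreover have "?T \<subseteq> States (partial_ts P A B)"
    by (auto simp: completable_def partial_ts_def)
  ultimately have "sem (partial_ts P A B) (Mu h f) E \<subseteq> ?T"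
    by (intro sem_Mu_lowerbound[OF Ext_partial_subset])
  then show ?case unfolding M_def .
qed auto

lemma sat_partial_imp_normal:
  assumes "wf_program P" "A \<noteq> {}" "B \<noteq> {}" "no_NegAtom_AX f" "no_Conj_Nu f"
    and "sat (partial_ts P A B) s f"
  obtains F G t where "F \<subseteq> A" "finite F" "F \<noteq> {}" "G \<subseteq> B" "finite G" "G \<noteq> {}"
    "sat (normal_ts P F G) t f" "extends P t s"
proof -
  have "sem (partial_ts P A B) f (\<lambda>_. {})
      \<subseteq> completable P A B (\<lambda>F G. sem (normal_ts P F G) f (\<lambda>_. {}))"
    using assms(1,3-5) by (intro sem_partial_subset_completable) auto
  with assms(6) have "s \<in> completable P A B (\<lambda>F G. sem (normal_ts P F G) f (\<lambda>_. {}))"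
    by (auto simp: sat_def)
  then have s: "\<forall>\<^sub>F (F, G) in large_finite A B. \<exists>t. sat (normal_ts P F G) t f \<and> extends P t s"
    by (simp add: completable_def sat_def Bex_def)
  \<comment> \<open>Large instances contain \<open>u\<close> and \<open>w\<close>, which rules out
    empty ones.\<close>
  obtain u w where "u \<in> A" "w \<in> B" using assms(2,3) by blast
  then have "\<forall>\<^sub>F (F, G) in large_finite A B. (finite F \<and> {u} \<subseteq> F \<and> F \<subseteq> A) \<and> (finite G \<and> {w} \<subseteq> G \<and> G \<subseteq> B)"
    by (intro eventually_large_finite) auto
  with s have "\<forall>\<^sub>F (F, G) in large_finite A B. F \<subseteq> A \<and> finite F \<and> F \<noteq> {} \<and> G \<subseteq> B \<and> finite G \<and> G \<noteq> {} \<and>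
      (\<exists>t. sat (normal_ts P F G) t f \<and> extends P t s)"
    by eventually_elim auto
  \<comment> \<open>The product filter is proper, so what holds eventually holds for some
    instance.\<close>
  from eventually_happens'[OF _ this] show ?thesis
    using that by (auto simp: prod_filter_eq_bot)
qed

lemma sat_normal_in_states: "sat (normal_ts P A B) s f \<Longrightarrow> s \<in> states_normal P A B"
  using sem_subset[OF Ext_normal_subset, of "\<lambda>_. {}" P A B f] by (auto simp: sat_def normal_ts_def)

theorem theorem2:
  fixes P :: "('b, 'x, 'y, 'a) program"
    and b0 :: 'b
    and Astar :: "'u set"
    and Bstar :: "'v set"
  assumes "wf_program P"
    and "b0 \<in> BoolVars P"
    and "infinite Astar"
    and "infinite Bstar"
  shows "(\<forall>f \<in> dual_logic (L2 (BoolVars P) :: ('b, 'h) mu set).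
            sat_from (partial_ts P Astar Bstar) b0 f \<longrightarrow>
            (\<forall>A B. A \<subseteq> Astar \<and> finite A \<and> A \<noteq> {} \<and> B \<subseteq> Bstar \<and> finite B \<and> B \<noteq> {} \<longrightarrow>
               sat_from (normal_ts P A B) b0 f)) \<and>
         (\<forall>f \<in> dual_logic (L4 (BoolVars P) :: ('b, 'h) mu set).
            sat_from (partial_ts P Astar Bstar) b0 f \<longleftrightarrow>
            (\<forall>A B. A \<subseteq> Astar \<and> finite A \<and> A \<noteq> {} \<and> B \<subseteq> Bstar \<and> finite B \<and> B \<noteq> {} \<longrightarrow>
               sat_from (normal_ts P A B) b0 f))"
proof -
  let ?finite_instances_sat = "\<lambda>f :: ('b, 'h) mu. \<forall>A B.
    A \<subseteq> Astar \<and> finite A \<and> A \<noteq> {} \<and> B \<subseteq> Bstar \<and> finite B \<and> B \<noteq> {} \<longrightarrow>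
      sat_from (normal_ts P A B) b0 f"
  have sound: "?finite_instances_sat (dual g)"
    if g: "g \<in> L2 (BoolVars P)" and sat: "sat_from (partial_ts P Astar Bstar) b0 (dual g)" for g
  proof (intro allI impI)
    fix A B
    assume AB: "A \<subseteq> Astar \<and> finite A \<and> A \<noteq> {} \<and> B \<subseteq> Bstar \<and> finite B \<and> B \<noteq> {}"
    have closed: "closed_formula g" and "no_NegAtom_AX g" using g by (auto simp: L2_def)
    \<comment> \<open>An initial state of a finite instance is, unchanged, an initial state of the
      partial-functions semantics, so a counterexample to \<open>dual g\<close>, being a state that
      satisfies \<open>g\<close>, carries over.\<close>
    moreover have "Ext (normal_ts P A B) b0 \<subseteq> Ext (partial_ts P Astar Bstar) b0"
      using AB states_normal_subset_partial[of A Astar B Bstar P]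
      by (auto simp: normal_ts_def partial_ts_def)
    ultimately show "sat_from (normal_ts P A B) b0 (dual g)"
      using sat AB sat_normal_imp_partial[OF assms(1), of A Astar B Bstar g]
      by (auto simp: sat_from_dual[OF Ext_normal_subset Succ_normal_subset closed]
          sat_from_dual[OF Ext_partial_subset Succ_partial_subset closed])
  qed
  have complete: "sat_from (partial_ts P Astar Bstar) b0 (dual g)"
    if g: "g \<in> L4 (BoolVars P)" and sat: "?finite_instances_sat (dual g)" for g
  proof -
    have closed: "closed_formula g" and frag: "no_NegAtom_AX g" "no_Conj_Nu g"
      using g by (auto simp: L4_def L2_def)
    have "\<not> sat (partial_ts P Astar Bstar) s g" if s: "s \<in> Ext (partial_ts P Astar Bstar) b0" for s
    proof
      assume "sat (partial_ts P Astar Bstar) s g"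
      moreover have "Astar \<noteq> {}" "Bstar \<noteq> {}" using assms(3,4) by auto
      ultimately obtain A B t where AB: "A \<subseteq> Astar" "finite A" "A \<noteq> {}" "B \<subseteq> Bstar" "finite B" "B \<noteq> {}"
        and t: "sat (normal_ts P A B) t g" "extends P t s"
        using sat_partial_imp_normal[OF assms(1) _ _ frag] by metis
      \<comment> \<open>A completion keeps the boolean values, so \<open>t\<close> is initial in its
        instance and refutes \<open>dual g\<close> there.\<close>
      have "t \<in> Ext (normal_ts P A B) b0"
        using s t(2) sat_normal_in_states[OF t(1)] by (auto simp: extends_def normal_ts_def partial_ts_def)
      moreover have "sat_from (normal_ts P A B) b0 (dual g)" using sat AB by blast
      ultimately show False
        using t(1) by (auto simp: sat_from_dual[OF Ext_normal_subset Succ_normal_subset closed])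
    qed
    then show ?thesis by (simp add: sat_from_dual[OF Ext_partial_subset Succ_partial_subset closed])
  qed
  have "L4 (BoolVars P) \<subseteq> (L2 (BoolVars P) :: ('b, 'h) mu set)" by (auto simp: L4_def)
  with sound complete show ?thesis unfolding dual_logic_def by blast
qed

end
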